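(* Let $T$ be a $d$-regular rooted tree with $d\ge 2$, and let $G\leq \mathrm{Aut}(T)$ be a finitely generated regular branch group. Then, for any finite subgroup $Q\leq G$, there exist uncountably many automorphism equivalence classes of weakly maximal subgroups of $G$ containing $Q$.
   Context: The $d$-regular rooted tree $T$ is the rooted tree in which every vertex has exactly $d$ children; its vertices are identified with finite words over an alphabet of $d$ letters (the root being the empty word). $\mathrm{Aut}(T)$ is the group of root-preserving automorphisms of $T$. Level $n$, denoted $\mathcal L_n$, is the set of vertices at distance $n$ from the root. For a vertex $v$, $T_v$ is the subtree of $T$ consisting of $v$ and all its descendants; it is identified with $T$ via $vw\leftrightarrow w$. For $G\le \mathrm{Aut}(T)$, $\mathrm{Stab}_G(v)$ is the stabilizer of the vertex $v$ and $\mathrm{Stab}_G(n)=\bigcap_{v\in\mathcal L_n}\mathrm{Stab}_G(v)$. Restriction gives maps $\psi_v\colon \mathrm{Stab}_G(v)\to \mathrm{Aut}(T)$, $\phi\mapsto \phi|_{T_v}$, and $\psi_1\colon \mathrm{Stab}_G(1)\to\mathrm{Aut}(T)^d$, $\phi\mapsto(\phi|_{T_{v_1}},\dots,\phi|_{T_{v_d}})$, where $v_1,\dots,v_d$ are the vertices of the first level. $G$ is self-similar if $\psi_v(\mathrm{Stab}_G(v))=G$ for every vertex $v$. $G$ is spherically transitive if it acts transitively on each level. $G$ is regular branch if it is spherically transitive, self-similar, and there exists a finite index subgroup $K$ of $G$ such that $K^d$ is contained in $\psi_1(K\cap \mathrm{Stab}_G(1))$ as a subgroup of finite index. A subgroup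 of $G$ is weakly maximal if it is maximal (with respect to inclusion) among the subgroups of infinite index in $G$. Two subgroups of $G$ are automorphism equivalent if some automorphism of the abstract group $G$ maps one onto the other. *)

theory Defs
  imports "HOL-Algebra.Algebra" "HOL-Library.Countable_Set" "HOL-Library.Cardinality"
begin

text \<open>
  The alphabet is a finite type \<open>'a\<close>, so that \<open>d = CARD('a)\<close>. The vertices of the \<open>d\<close>-regular
  rooted tree are all the words in \<open>'a list\<close>, with root \<open>[]\<close>, and the children of \<open>v\<close> are the
  words \<open>v @ [x]\<close>.
\<close>

definition tree_adj :: "'a list \<Rightarrow> 'a list \<Rightarrow> bool" where
  "tree_adj v w \<longleftrightarrow> (\<exists>x. w = v @ [x] \<or> v = w @ [x])"

definition tree_level :: "nat \<Rightarrow> 'a list set" where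
  "tree_level n = {v. length v = n}"

definition tree_automorphism :: "('a list \<Rightarrow> 'a list) \<Rightarrow> bool" where
  "tree_automorphism f \<longleftrightarrow>
     bij f \<and> f [] = [] \<and> (\<forall>v w. tree_adj (f v) (f w) \<longleftrightarrow> tree_adj v w)"

definition Aut_tree :: "('a list \<Rightarrow> 'a list) monoid" where
  "Aut_tree = \<lparr>carrier = {f. tree_automorphism f}, monoid.mult = (\<circ>), one = id\<rparr>"

text \<open>
  A subgroup of \<open>Aut(T)\<close> is given by its carrier \<open>G\<close>; the corresponding group structure is
  \<open>tree_group G\<close>.
\<close>

abbreviation tree_group :: "('a list \<Rightarrow> 'a list) set \<Rightarrow> ('a list \<Rightarrow> 'a list) monoid" where
  "tree_group G \<equiv> Aut_tree\<lparr>carrier := G\<rparr>"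

definition vertex_stab :: "('a list \<Rightarrow> 'a list) set \<Rightarrow> 'a list \<Rightarrow> ('a list \<Rightarrow> 'a list) set" where
  "vertex_stab G v = {g \<in> G. g v = v}"

definition level_stab :: "('a list \<Rightarrow> 'a list) set \<Rightarrow> nat \<Rightarrow> ('a list \<Rightarrow> 'a list) set" where
  "level_stab G n = (\<Inter>v\<in>tree_level n. vertex_stab G v)"

text \<open>
  The restriction of \<open>f\<close> to the subtree \<open>T\<^sub>v = {v @ w | w}\<close>, transported to the whole tree along
  \<open>v @ w \<leftrightarrow> w\<close>. It is meaningful only for tree automorphisms \<open>f\<close> with \<open>f v = v\<close>, for which
  \<open>f (v @ w)\<close> again has the prefix \<open>v\<close>.
\<close>

definition psi_at :: "'a list \<Rightarrow> ('a list \<Rightarrow> 'a list) \<Rightarrow> ('a list \<Rightarrow> 'a list)" where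
  "psi_at v f = (\<lambda>w. drop (length v) (f (v @ w)))"

definition psi_one :: "('a list \<Rightarrow> 'a list) \<Rightarrow> ('a \<Rightarrow> 'a list \<Rightarrow> 'a list)" where
  "psi_one f = (\<lambda>x. psi_at [x] f)"

definition finite_index_subgroup :: "'g set \<Rightarrow> ('g, 'm) monoid_scheme \<Rightarrow> bool" where
  "finite_index_subgroup H G \<longleftrightarrow> subgroup H G \<and> finite (rcosets\<^bsub>G\<^esub> H)"

definition infinite_index_subgroup :: "'g set \<Rightarrow> ('g, 'm) monoid_scheme \<Rightarrow> bool" where
  "infinite_index_subgroup H G \<longleftrightarrow> subgroup H G \<and> infinite (rcosets\<^bsub>G\<^esub> H)"

definition finitely_generated_group :: "('g, 'm) monoid_scheme \<Rightarrow> bool" where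
  "finitely_generated_group G \<longleftrightarrow>
     (\<exists>S. finite S \<and> S \<subseteq> carrier G \<and> generate G S = carrier G)"

definition self_similar :: "('a list \<Rightarrow> 'a list) set \<Rightarrow> bool" where
  "self_similar G \<longleftrightarrow> (\<forall>v. psi_at v ` vertex_stab G v = G)"

definition spherically_transitive :: "('a list \<Rightarrow> 'a list) set \<Rightarrow> bool" where
  "spherically_transitive G \<longleftrightarrow>
     (\<forall>n. \<forall>v\<in>tree_level n. \<forall>w\<in>tree_level n. \<exists>g\<in>G. g v = w)"

text \<open>
  \<open>K\<^sup>d\<close> is the set of all functions from the alphabet to \<open>K\<close>, viewed inside the direct power
  \<open>Aut(T)\<^sup>d\<close>.
\<close>

definition regular_branch :: "('a::finite list \<Rightarrow> 'a list) set \<Rightarrow> bool" where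
  "regular_branch G \<longleftrightarrow>
     spherically_transitive G \<and> self_similar G \<and>
     (\<exists>K. finite_index_subgroup K (tree_group G) \<and>
          finite_index_subgroup (\<Pi>\<^sub>E x\<in>UNIV. K)
            ((product_group UNIV (\<lambda>x. Aut_tree))
               \<lparr>carrier := psi_one ` (K \<inter> level_stab G 1)\<rparr>))"

definition weakly_maximal :: "'g set \<Rightarrow> ('g, 'm) monoid_scheme \<Rightarrow> bool" where
  "weakly_maximal W G \<longleftrightarrow>
     infinite_index_subgroup W G \<and>
     (\<forall>L. infinite_index_subgroup L G \<and> W \<subseteq> L \<longrightarrow> L = W)"

definition automorphism_equiv :: "('g, 'm) monoid_scheme \<Rightarrow> 'g set rel" where
  "automorphism_equiv G =
     {(A, B). subgroup A G \<and> subgroup B G \<and> (\<exists>\<phi>\<in>iso G G. \<phi> ` A = B)}"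

end

theory Submission
  imports Defs
begin

text \<open>
  A finitely generated group has only countably many automorphisms, so the automorphism classes
  of subgroups are countable and it suffices to find uncountably many weakly maximal subgroups
  containing \<open>Q\<close>. For a ray \<open>\<xi>\<close>, the setwise stabilizer of the finite orbit \<open>Q\<xi>\<close> contains \<open>Q\<close>
  and has infinite index, as \<open>G\<close> is spherically transitive; by Zorn's lemma it lies in a weakly
  maximal subgroup \<open>W\<^sub>\<xi>\<close>. It also contains the copy of \<open>K\<close> acting below each vertex off the
  rays of \<open>Q\<xi>\<close>. If \<open>Q\<xi>\<close> and \<open>Q\<eta>\<close> are disjoint, they are already disjoint at some level \<open>n\<close>,
  and \<open>W\<^sub>\<xi> = W\<^sub>\<eta>\<close> would contain the copies of \<open>K\<close> at all vertices of level \<open>n\<close>, which generate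
  a subgroup of finite index. So \<open>\<xi> \<mapsto> W\<^sub>\<xi>\<close> has finite fibres on the uncountable set of rays.
\<close>

section \<open>Subgroups of finite index\<close>

context group
begin

text \<open>\<open>H #> g = H #> r\<close> exactly when \<open>g \<otimes> inv r\<close> lies in
  \<open>H\<close>. This turns finite index into a statement about elements; \<open>R\<close> has to
  meet every right coset, possibly more than once.\<close>

lemma finite_rcosets_iff:
  assumes H: "subgroup H G"
  shows "finite (rcosets H) \<longleftrightarrow>
    (\<exists>R. finite R \<and> R \<subseteq> carrier G \<and> (\<forall>g\<in>carrier G. \<exists>r\<in>R. g \<otimes> inv r \<in> H))"
proof
  assume fin: "finite (rcosets H)"
  have *: "\<exists>r. r \<in> carrier G \<and> C = H #> r" if "C \<in> rcosets H" for C
    using that by (auto simp: RCOSETS_def)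
  define rep where "rep C = (SOME r. r \<in> carrier G \<and> C = H #> r)" for C
  have rep: "rep C \<in> carrier G \<and> C = H #> rep C" if "C \<in> rcosets H" for C
    unfolding rep_def by (rule someI_ex) (rule *[OF that])
  show "\<exists>R. finite R \<and> R \<subseteq> carrier G \<and> (\<forall>g\<in>carrier G. \<exists>r\<in>R. g \<otimes> inv r \<in> H)"
  proof (intro exI conjI ballI)
    show "finite (rep ` (rcosets H))" "rep ` (rcosets H) \<subseteq> carrier G"
      using fin rep by auto
    fix g assume g: "g \<in> carrier G"
    have mem: "H #> g \<in> rcosets H"
      using g H by (simp add: rcosetsI subgroup.subset)
    have "g \<in> H #> rep (H #> g)"
      using rep[OF mem] rcos_self[OF g H] by simp
    then obtain h where h: "h \<in> H" "g = h \<otimes> rep (H #> g)"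
      by (auto simp: r_coset_def)
    have "g \<otimes> inv (rep (H #> g)) = h"
      using h rep[OF mem] H by (metis inv_solve_right subgroup.mem_carrier g)
    then show "\<exists>r\<in>rep ` (rcosets H). g \<otimes> inv r \<in> H"
      using h mem by auto
  qed
next
  assume "\<exists>R. finite R \<and> R \<subseteq> carrier G \<and> (\<forall>g\<in>carrier G. \<exists>r\<in>R. g \<otimes> inv r \<in> H)"
  then obtain R where R: "finite R" "R \<subseteq> carrier G"
    "\<And>g. g \<in> carrier G \<Longrightarrow> \<exists>r\<in>R. g \<otimes> inv r \<in> H"
    by auto
  have "rcosets H \<subseteq> (\<lambda>r. H #> r) ` R"
  proof
    fix C assume "C \<in> rcosets H"
    then obtain g where g: "g \<in> carrier G" "C = H #> g"
      by (auto simp: RCOSETS_def)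
    obtain r where r: "r \<in> R" "g \<otimes> inv r \<in> H"
      using R(3)[OF g(1)] by auto
    have "g = (g \<otimes> inv r) \<otimes> r"
      using g r R by (auto simp: m_assoc subset_iff)
    then have "g \<in> H #> r"
      using r unfolding r_coset_def by blast
    then have "H #> r = H #> g"
      using repr_independence H R r by blast
    then show "C \<in> (\<lambda>r. H #> r) ` R"
      using g r by blast
  qed
  with R(1) show "finite (rcosets H)"
    by (rule finite_surj)
qed

text \<open>One element from each of the finitely many fibres of \<open>f\<close> gives a set
  meeting every coset. The fibres of \<open>f\<close> may be finer than the cosets.\<close>

lemma finite_rcosetsI:
  assumes H: "subgroup H G" and fin: "finite (f ` carrier G)"
    and f: "\<And>g h. g \<in> carrier G \<Longrightarrow> h \<in> carrier G \<Longrightarrow> f g = f h \<Longrightarrow> g \<otimes> inv h \<in> H"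
  shows "finite (rcosets H)"
proof -
  let ?r = "inv_into (carrier G) f"
  have "\<forall>g\<in>carrier G. \<exists>r\<in>?r ` f ` carrier G. g \<otimes> inv r \<in> H"
  proof
    fix g assume g: "g \<in> carrier G"
    then have "?r (f g) \<in> carrier G" "f (?r (f g)) = f g"
      by (simp_all add: inv_into_into f_inv_into_f)
    then have "g \<otimes> inv ?r (f g) \<in> H"
      using f[OF g] by simp
    then show "\<exists>r\<in>?r ` f ` carrier G. g \<otimes> inv r \<in> H"
      using g by blast
  qed
  moreover have "?r ` f ` carrier G \<subseteq> carrier G"
    by (auto intro: inv_into_into)
  ultimately show ?thesis
    unfolding finite_rcosets_iff[OF H] using fin by (metis finite_imageI)
qed

lemma finite_rcosets_mono:
  assumes "subgroup H G" "subgroup L G" "H \<subseteq> L" "finite (rcosets H)"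
  shows "finite (rcosets L)"
  using assms unfolding finite_rcosets_iff[OF assms(1)] finite_rcosets_iff[OF assms(2)]
  by (meson subsetD)

text \<open>An element is coded by the tuple of its cosets modulo the \<open>H i\<close>.
  \<open>I\<close> is nonempty because an empty intersection is \<open>UNIV\<close> and not the
  carrier.\<close>

lemma finite_rcosets_INT:
  assumes I: "finite I" "I \<noteq> {}"
    and H: "\<And>i. i \<in> I \<Longrightarrow> subgroup (H i) G" "\<And>i. i \<in> I \<Longrightarrow> finite (rcosets (H i))"
  shows "finite (rcosets (\<Inter>i\<in>I. H i))"
proof (rule finite_rcosetsI)
  show "subgroup (\<Inter>i\<in>I. H i) G"
    using subgroups_Inter[of "H ` I"] I H by auto
  let ?f = "\<lambda>g. restrict (\<lambda>i. H i #> g) I"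
  have "?f ` carrier G \<subseteq> (\<Pi>\<^sub>E i\<in>I. rcosets (H i))"
    using H by (auto simp: rcosetsI subgroup.subset)
  then show "finite (?f ` carrier G)"
    using finite_PiE[OF I(1)] H(2) finite_subset by metis
  fix g h assume gh: "g \<in> carrier G" "h \<in> carrier G" "?f g = ?f h"
  show "g \<otimes> inv h \<in> (\<Inter>i\<in>I. H i)"
  proof
    fix i assume i: "i \<in> I"
    have "H i #> g = H i #> h"
      using fun_cong[OF gh(3), of i] i by simp
    then have "g \<in> H i #> h"
      using rcos_self[OF gh(1) H(1)[OF i]] by simp
    then obtain k where "k \<in> H i" "g = k \<otimes> h"
      by (auto simp: r_coset_def)
    then show "g \<otimes> inv h \<in> H i"
      using H(1)[OF i] gh by (metis inv_solve_right subgroup.mem_carrier)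
  qed
qed

text \<open>Write \<open>g\<close> as \<open>s \<otimes> r\<close> with \<open>s\<close> in
  \<open>S\<close> and \<open>r\<close> a representative modulo \<open>S\<close>. The pair of
  \<open>r\<close> and the representative of \<open>\<psi> s\<close> modulo \<open>K\<close> takes
  finitely many values and separates the cosets.\<close>

lemma finite_rcosets_preimage:
  assumes S: "subgroup S G" "finite (rcosets S)"
    and G': "group G'" and K: "subgroup K G'" "finite (rcosets\<^bsub>G'\<^esub> K)"
    and \<psi>: "\<psi> \<in> hom (G\<lparr>carrier := S\<rparr>) G'"
  shows "subgroup {s \<in> S. \<psi> s \<in> K} G \<and> finite (rcosets {s \<in> S. \<psi> s \<in> K})"
proof -
  interpret G': group G' by fact
  interpret S: group "G\<lparr>carrier := S\<rparr>"
    using S subgroup.subgroup_is_group is_group by blast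
  interpret \<psi>: group_hom "G\<lparr>carrier := S\<rparr>" G' \<psi>
    using \<psi> by unfold_locales
  note Sc = subgroup.mem_carrier[OF S(1)]
  have \<psi>c: "\<psi> a \<in> carrier G'" if "a \<in> S" for a
    using that \<psi>.hom_closed by simp
  have \<psi>m: "\<psi> (a \<otimes> b) = \<psi> a \<otimes>\<^bsub>G'\<^esub> \<psi> b" if "a \<in> S" "b \<in> S" for a b
    using that \<psi>.hom_mult by simp
  have \<psi>i: "\<psi> (inv a) = inv\<^bsub>G'\<^esub> \<psi> a" if "a \<in> S" for a
    using that \<psi>.hom_inv[of a] m_inv_consistent[OF S(1) that] by simp
  have \<psi>1: "\<psi> \<one> = \<one>\<^bsub>G'\<^esub>"
    using \<psi>.hom_one by simp
  have sub: "subgroup {s \<in> S. \<psi> s \<in> K} G"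
  proof (rule subgroupI)
    show "{s \<in> S. \<psi> s \<in> K} \<subseteq> carrier G"
      using Sc by auto
    show "{s \<in> S. \<psi> s \<in> K} \<noteq> {}"
      using subgroup.one_closed[OF S(1)] subgroup.one_closed[OF K(1)] \<psi>1 by auto
  qed (auto simp: \<psi>i \<psi>m S(1) K(1) subgroup.m_inv_closed subgroup.m_closed)
  obtain R where R: "finite R" "R \<subseteq> carrier G" "\<And>g. g \<in> carrier G \<Longrightarrow> \<exists>r\<in>R. g \<otimes> inv r \<in> S"
    using S(2) unfolding finite_rcosets_iff[OF S(1)] by auto
  obtain R' where R': "finite R'" "R' \<subseteq> carrier G'"
    "\<And>g. g \<in> carrier G' \<Longrightarrow> \<exists>r\<in>R'. g \<otimes>\<^bsub>G'\<^esub> inv\<^bsub>G'\<^esub> r \<in> K"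
    using K(2) unfolding G'.finite_rcosets_iff[OF K(1)] by auto
  obtain r where r: "\<And>g. g \<in> carrier G \<Longrightarrow> r g \<in> R \<and> g \<otimes> inv r g \<in> S"
    using R(3) by metis
  obtain r' where r': "\<And>g. g \<in> carrier G' \<Longrightarrow> r' g \<in> R' \<and> g \<otimes>\<^bsub>G'\<^esub> inv\<^bsub>G'\<^esub> r' g \<in> K"
    using R'(3) by metis
  let ?f = "\<lambda>g. (r g, r' (\<psi> (g \<otimes> inv r g)))"
  have "finite (rcosets {s \<in> S. \<psi> s \<in> K})"
  proof (rule finite_rcosetsI[OF sub])
    have "?f ` carrier G \<subseteq> R \<times> R'"
      using r r' \<psi>c by auto
    then show "finite (?f ` carrier G)"
      using R(1) R'(1) finite_subset by blast
    fix g h assume g: "g \<in> carrier G" and h: "h \<in> carrier G" and eq: "?f g = ?f h"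
    define a where "a = g \<otimes> inv r g"
    define b where "b = h \<otimes> inv r h"
    have ab: "a \<in> S" "b \<in> S"
      using r g h by (auto simp: a_def b_def)
    have rc: "r h \<in> carrier G" "r g = r h"
      using r[OF h] R(2) eq by auto
    \<comment> \<open>The common representative \<open>r g = r h\<close> cancels, so the quotient is
      computed inside \<open>S\<close>, where \<open>\<psi>\<close> is multiplicative.\<close>
    have gh: "g \<otimes> inv h = a \<otimes> inv b"
      using g h rc by (simp add: a_def b_def inv_mult_group m_assoc inv_solve_left)
    define t where "t = r' (\<psi> b)"
    have t: "t \<in> carrier G'" "\<psi> a \<otimes>\<^bsub>G'\<^esub> inv\<^bsub>G'\<^esub> t \<in> K" "\<psi> b \<otimes>\<^bsub>G'\<^esub> inv\<^bsub>G'\<^esub> t \<in> K"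
      using r'[OF \<psi>c[OF ab(1)]] r'[OF \<psi>c[OF ab(2)]] eq R'(2)
      by (auto simp: t_def a_def b_def)
    have "\<psi> (a \<otimes> inv b) = \<psi> a \<otimes>\<^bsub>G'\<^esub> inv\<^bsub>G'\<^esub> \<psi> b"
      using ab S(1) by (simp add: \<psi>m \<psi>i subgroup.m_inv_closed)
    also have "\<dots> = (\<psi> a \<otimes>\<^bsub>G'\<^esub> inv\<^bsub>G'\<^esub> t) \<otimes>\<^bsub>G'\<^esub> inv\<^bsub>G'\<^esub> (\<psi> b \<otimes>\<^bsub>G'\<^esub> inv\<^bsub>G'\<^esub> t)"
      using \<psi>c ab t(1) by (simp add: G'.inv_mult_group G'.m_assoc G'.inv_solve_left)
    also have "\<dots> \<in> K"
      using t K(1) by (simp add: subgroup.m_closed subgroup.m_inv_closed)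
    finally show "g \<otimes> inv h \<in> {s \<in> S. \<psi> s \<in> K}"
      using gh ab S(1) by (simp add: subgroup.m_closed subgroup.m_inv_closed)
  qed
  with sub show ?thesis by blast
qed

section \<open>Weakly maximal subgroups of finitely generated groups\<close>

lemma subgroup_Union_chain:
  assumes "C \<noteq> {}" "\<And>H. H \<in> C \<Longrightarrow> subgroup H G"
    and ch: "\<And>H L. H \<in> C \<Longrightarrow> L \<in> C \<Longrightarrow> H \<subseteq> L \<or> L \<subseteq> H"
  shows "subgroup (\<Union>C) G"
proof (rule subgroupI)
  show "\<Union>C \<subseteq> carrier G" "\<Union>C \<noteq> {}"
    using assms(1,2) subgroup.subset subgroup.one_closed by blast+
  show "inv a \<in> \<Union>C" if "a \<in> \<Union>C" for a
    using that assms(2) by (meson UnionE UnionI subgroup.m_inv_closed)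
  show "a \<otimes> b \<in> \<Union>C" if ab: "a \<in> \<Union>C" "b \<in> \<Union>C" for a b
  proof -
    obtain H L where HL: "H \<in> C" "a \<in> H" "L \<in> C" "b \<in> L"
      using ab by auto
    then have "\<exists>M\<in>C. a \<in> M \<and> b \<in> M"
      using ch[of H L] by blast
    then show ?thesis
      using assms(2) by (meson UnionI subgroup.m_closed)
  qed
qed

text \<open>
  If \<open>\<Union>C\<close> has the finite set \<open>R\<close> of coset representatives, then a single \<open>H \<in> C\<close> contains the
  finitely many Schreier elements \<open>r s r'\<^sup>-\<^sup>1\<close> lying in \<open>\<Union>C\<close>. The union of the cosets \<open>H r\<close>
  is then stable under right multiplication by the generators, hence everything.
\<close>

lemma infinite_rcosets_Union_chain:
  assumes fg: "finitely_generated_group G"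
    and C: "C \<noteq> {}" "\<And>H. H \<in> C \<Longrightarrow> infinite_index_subgroup H G"
    and ch: "\<And>H L. H \<in> C \<Longrightarrow> L \<in> C \<Longrightarrow> H \<subseteq> L \<or> L \<subseteq> H"
  shows "infinite_index_subgroup (\<Union>C) G"
proof -
  have Csub: "subgroup H G" if "H \<in> C" for H
    using C(2)[OF that] by (simp add: infinite_index_subgroup_def)
  have U: "subgroup (\<Union>C) G"
    using C(1) Csub ch by (rule subgroup_Union_chain)
  have "infinite (rcosets (\<Union>C))"
  proof
    assume "finite (rcosets (\<Union>C))"
    then obtain R where R: "finite R" "R \<subseteq> carrier G"
      "\<And>g. g \<in> carrier G \<Longrightarrow> \<exists>r\<in>R. g \<otimes> inv r \<in> \<Union>C"
      unfolding finite_rcosets_iff[OF U] by auto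
    obtain r where r: "\<And>g. g \<in> carrier G \<Longrightarrow> r g \<in> R" "\<And>g. g \<in> carrier G \<Longrightarrow> g \<otimes> inv r g \<in> \<Union>C"
      using R(3) by metis
    obtain S where S: "finite S" "S \<subseteq> carrier G" "generate G S = carrier G"
      using fg unfolding finitely_generated_group_def by auto
    \<comment> \<open>\<open>generate\<close> also admits inverses of generators, so
      \<open>Y\<close> below has to be stable under these too.\<close>
    define A where "A = S \<union> m_inv G ` S"
    have A: "finite A" "A \<subseteq> carrier G"
      using S by (auto simp: A_def)
    \<comment> \<open>The extra element \<open>\<one> \<otimes> inv r \<one>\<close> later places
      \<open>\<one>\<close> in \<open>Y\<close>, from where stability reaches the whole
      group.\<close>
    define F where "F = insert (\<one> \<otimes> inv r \<one>) ((\<lambda>(t, a). t \<otimes> a \<otimes> inv r (t \<otimes> a)) ` (R \<times> A))"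
    have F: "finite F" "F \<subseteq> \<Union>C"
      using R A r(2) unfolding F_def by (auto simp: subset_iff simp del: Union_iff r_one l_one)
    obtain H where H: "H \<in> C" "F \<subseteq> H"
      using finite_subset_Union_chain[OF F C(1)] ch
      by (metis subset_chain_def subset_UNIV)
    note Hs = Csub[OF H(1)]
    define Y where "Y = {h \<otimes> t | h t. h \<in> H \<and> t \<in> R}"
    have Yc: "Y \<subseteq> carrier G"
      using R(2) subgroup.mem_carrier[OF Hs] by (auto simp: Y_def)
    have step: "x \<otimes> a \<in> Y" if "x \<in> Y" "a \<in> A" for x a
    proof -
      obtain h t where ht: "h \<in> H" "t \<in> R" "x = h \<otimes> t"
        using \<open>x \<in> Y\<close> by (auto simp: Y_def)
      have c: "h \<in> carrier G" "t \<in> carrier G" "a \<in> carrier G"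
        using ht R A that Hs subgroup.mem_carrier by auto
      then have rc: "r (t \<otimes> a) \<in> R" "r (t \<otimes> a) \<in> carrier G"
        using r R by auto
      let ?u = "t \<otimes> a \<otimes> inv r (t \<otimes> a)"
      have "?u \<in> H"
        using H(2) ht that unfolding F_def by blast
      then have "h \<otimes> ?u \<in> H"
        using ht Hs subgroup.m_closed by metis
      moreover have "x \<otimes> a = h \<otimes> ?u \<otimes> r (t \<otimes> a)"
        using c rc ht by (simp add: m_assoc)
      ultimately show ?thesis
        using rc unfolding Y_def by blast
    qed
    have "x \<in> Y \<longrightarrow> x \<otimes> g \<in> Y" if "g \<in> generate G S" for g x
      using that
    proof (induction arbitrary: x rule: generate.induct)
      case one
      show ?case using Yc by auto
    next
      case (incl h)
      then show ?case using step by (auto simp: A_def)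
    next
      case (inv h)
      then show ?case using step by (auto simp: A_def)
    next
      case (eng h1 h2)
      have "h1 \<in> carrier G" "h2 \<in> carrier G"
        using eng.hyps S(3) by auto
      then have "x \<otimes> (h1 \<otimes> h2) = x \<otimes> h1 \<otimes> h2" if "x \<in> Y"
        using that Yc by (simp add: m_assoc subsetD)
      then show ?case
        using eng.IH by simp
    qed
    then have closed: "x \<otimes> g \<in> Y" if "x \<in> Y" "g \<in> carrier G" for x g
      using that S by auto
    have "\<one> \<otimes> inv r \<one> \<in> H"
      using H(2) by (auto simp: F_def)
    then have "(\<one> \<otimes> inv r \<one>) \<otimes> r \<one> \<in> Y"
      using r(1)[OF one_closed] unfolding Y_def by blast
    moreover have "(\<one> \<otimes> inv r \<one>) \<otimes> r \<one> = \<one>"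
      using r(1)[OF one_closed] R(2) by auto
    ultimately have all: "g \<in> Y" if "g \<in> carrier G" for g
      using closed[of \<one> g] that by simp
    have "finite (rcosets H)"
      unfolding finite_rcosets_iff[OF Hs]
    proof (intro exI conjI ballI)
      fix g assume "g \<in> carrier G"
      then obtain h t where ht: "h \<in> H" "t \<in> R" "g = h \<otimes> t"
        using all[of g] unfolding Y_def by blast
      then have "g \<otimes> inv t = h"
        using R(2) Hs subgroup.mem_carrier by (fastforce simp: m_assoc)
      then show "\<exists>t\<in>R. g \<otimes> inv t \<in> H"
        using ht(1,2) by blast
    qed (use R in auto)
    then show False
      using C(2)[OF H(1)] by (simp add: infinite_index_subgroup_def)
  qed
  with U show ?thesis
    by (simp add: infinite_index_subgroup_def)
qed

text \<open>Zorn's lemma for the infinite-index subgroups above \<open>H\<close>; finite generation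
  keeps unions of chains of infinite index.\<close>

lemma exists_weakly_maximal:
  assumes fg: "finitely_generated_group G" and H: "infinite_index_subgroup H G"
  shows "\<exists>W. weakly_maximal W G \<and> H \<subseteq> W"
proof -
  let ?A = "{L. infinite_index_subgroup L G \<and> H \<subseteq> L}"
  have "\<exists>M\<in>?A. \<forall>Y\<in>?A. M \<subseteq> Y \<longrightarrow> Y = M"
  proof (rule subset_Zorn_nonempty)
    show "?A \<noteq> {}" using H by auto
    fix C assume C: "C \<noteq> {}" "subset.chain ?A C"
    then have "infinite_index_subgroup (\<Union>C) G"
      by (intro infinite_rcosets_Union_chain fg) (auto simp: subset_chain_def)
    moreover have "H \<subseteq> \<Union>C"
      using C unfolding subset_chain_def by blast
    ultimately show "\<Union>C \<in> ?A" by simp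
  qed
  then obtain M where "M \<in> ?A" "\<forall>Y\<in>?A. M \<subseteq> Y \<longrightarrow> Y = M" ..
  then have "weakly_maximal M G \<and> H \<subseteq> M"
    unfolding weakly_maximal_def by auto
  then show ?thesis ..
qed

section \<open>Countability of automorphism classes\<close>

text \<open>Each element is the value of a word in the generators and their inverses, and there are
  countably many such words.\<close>

lemma countable_generate:
  assumes "countable S" "S \<subseteq> carrier G"
  shows "countable (generate G S)"
proof -
  define A where "A = S \<union> m_inv G ` S"
  define p where "p xs = foldr (\<otimes>) xs \<one>" for xs
  have A: "A \<subseteq> carrier G" using assms by (auto simp: A_def)
  have pc: "p xs \<in> carrier G" if "xs \<in> lists A" for xs
    using that A by (induction xs) (auto simp: p_def)
  have app: "p (xs @ ys) = p xs \<otimes> p ys" if "xs \<in> lists A" "ys \<in> lists A" for xs ys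
    using that(1)
  proof (induction xs)
    case Nil
    then show ?case using pc[OF that(2)] by (simp add: p_def)
  next
    case (Cons a xs)
    then show ?case
      using pc[of xs] pc[OF that(2)] A by (auto simp: p_def m_assoc)
  qed
  have single: "p [a] = a" if "a \<in> A" for a
    using that A by (auto simp: p_def)
  have "g \<in> p ` lists A" if "g \<in> generate G S" for g
    using that
  proof (induction rule: generate.induct)
    case one
    show ?case by (rule image_eqI[of _ _ "[]"]) (auto simp: p_def)
  next
    case (incl h)
    then show ?case using single[of h] by (intro image_eqI[of _ _ "[h]"]) (auto simp: A_def)
  next
    case (inv h)
    then show ?case
      using single[of "inv h"] by (intro image_eqI[of _ _ "[inv h]"]) (auto simp: A_def)
  next
    case (eng h1 h2)
    then obtain xs ys where "xs \<in> lists A" "ys \<in> lists A" "h1 = p xs" "h2 = p ys"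
      by auto
    then show ?case using app by (intro image_eqI[of _ _ "xs @ ys"]) auto
  qed
  moreover have "countable (lists A)"
    using assms(1) by (intro countable_lists) (simp add: A_def)
  ultimately show ?thesis
    by (meson countable_image countable_subset subsetI)
qed

lemma hom_eq_on_generate:
  assumes S: "S \<subseteq> carrier G" and f: "f \<in> hom G G" and h: "h \<in> hom G G"
    and eq: "\<And>s. s \<in> S \<Longrightarrow> f s = h s" and x: "x \<in> generate G S"
  shows "f x = h x"
proof -
  interpret f: group_hom G G f using f by unfold_locales
  interpret h: group_hom G G h using h by unfold_locales
  show ?thesis
    using x
  proof (induction rule: generate.induct)
    case (inv s)
    then show ?case using S eq f.hom_inv h.hom_inv by auto
  next
    case (eng a b)
    then show ?case using generate_in_carrier[OF S] by simp
  qed (auto simp: eq)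
qed

text \<open>An automorphism is determined by the images of finitely many generators, a finite list
  over a countable group.\<close>

lemma countable_automorphism_class:
  assumes fg: "finitely_generated_group G"
  shows "countable (automorphism_equiv G `` {A})"
proof (cases "subgroup A G")
  case True
  obtain S where S: "finite S" "S \<subseteq> carrier G" "generate G S = carrier G"
    using fg unfolding finitely_generated_group_def by auto
  have cG: "countable (carrier G)"
    using countable_generate[of S] S by (metis countable_finite)
  obtain xs where xs: "set xs = S"
    using finite_list[OF S(1)] by blast
  \<comment> \<open>Members of \<open>iso G G\<close> are total functions with arbitrary values off
    the carrier, so \<open>iso G G\<close> itself may be uncountable; the lists of values on the
    generators are counted instead.\<close>
  let ?\<rho> = "\<lambda>\<phi>. map \<phi> xs"
  have "?\<rho> ` iso G G \<subseteq> lists (carrier G)"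
    using S(2) xs by (auto simp: iso_def hom_def Pi_iff subset_iff)
  then have c: "countable (?\<rho> ` iso G G)"
    by (rule countable_subset) (rule countable_lists[OF cG])
  have "automorphism_equiv G `` {A} \<subseteq> (\<lambda>r. inv_into (iso G G) ?\<rho> r ` A) ` ?\<rho> ` iso G G"
  proof
    fix B assume "B \<in> automorphism_equiv G `` {A}"
    then obtain \<phi> where \<phi>: "\<phi> \<in> iso G G" "\<phi> ` A = B"
      by (auto simp: automorphism_equiv_def)
    \<comment> \<open>\<open>\<chi>\<close> agrees with \<open>\<phi>\<close> on the generators,
      hence on the carrier and on \<open>A\<close>, but possibly not elsewhere.\<close>
    define \<chi> where "\<chi> = inv_into (iso G G) ?\<rho> (?\<rho> \<phi>)"
    have \<chi>: "\<chi> \<in> iso G G" "?\<rho> \<chi> = ?\<rho> \<phi>"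
      unfolding \<chi>_def using \<phi>(1) inv_into_into[of "?\<rho> \<phi>" ?\<rho> "iso G G"]
        f_inv_into_f[of "?\<rho> \<phi>" ?\<rho> "iso G G"] by blast+
    have "\<chi> x = \<phi> x" if "x \<in> carrier G" for x
    proof (rule hom_eq_on_generate[OF S(2), where f = \<chi> and h = \<phi>])
      show "\<chi> \<in> hom G G" "\<phi> \<in> hom G G"
        using \<chi> \<phi> by (auto simp: iso_def)
      show "\<chi> s = \<phi> s" if "s \<in> S" for s
        using \<chi>(2) that xs by simp
    qed (use that S in simp)
    then have "\<chi> ` A = B"
      using \<phi>(2) subgroup.subset[OF True] by (auto intro!: image_cong)
    then show "B \<in> (\<lambda>r. inv_into (iso G G) ?\<rho> r ` A) ` ?\<rho> ` iso G G"
      using \<phi>(1) unfolding \<chi>_def by blast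
  qed
  then show ?thesis
    using c by (meson countable_image countable_subset)
next
  case False
  then have "automorphism_equiv G `` {A} = {}"
    by (auto simp: automorphism_equiv_def)
  then show ?thesis by simp
qed

text \<open>A class may contain subgroups outside \<open>\<W>\<close>, but by reflexivity the
  classes cover \<open>\<W>\<close>, and each of them is countable.\<close>

lemma countable_if_countable_automorphism_classes:
  assumes fg: "finitely_generated_group G" and sub: "\<And>A. A \<in> \<W> \<Longrightarrow> subgroup A G"
    and c: "countable (\<W> // automorphism_equiv G)"
  shows "countable \<W>"
proof -
  have "\<W> \<subseteq> \<Union>(\<W> // automorphism_equiv G)"
  proof
    fix A assume A: "A \<in> \<W>"
    have "(A, A) \<in> automorphism_equiv G"
      using sub[OF A] id_iso unfolding automorphism_equiv_def
      by (auto intro!: bexI[of _ "\<lambda>x. x"] simp: iso_set_refl)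
    then show "A \<in> \<Union>(\<W> // automorphism_equiv G)"
      using A by (auto simp: quotient_def)
  qed
  moreover have "countable C" if "C \<in> \<W> // automorphism_equiv G" for C
    using that countable_automorphism_class[OF fg] by (auto elim: quotientE)
  then have "countable (\<Union>(\<W> // automorphism_equiv G))"
    using countable_UN[OF c, of "\<lambda>C. C"] by simp
  ultimately show ?thesis
    using countable_subset by blast
qed

end

section \<open>Tree automorphisms\<close>

abbreviation fun_inv :: "('b \<Rightarrow> 'b) \<Rightarrow> 'b \<Rightarrow> 'b" where
  "fun_inv \<equiv> inv_into UNIV"

text \<open>Adjacency does not distinguish parents from children. By induction from the fixed root,
  the parent of \<open>f v\<close> is already the image of the parent of \<open>v\<close>, so by
  injectivity a child of \<open>v\<close> can only go to a child of \<open>f v\<close>.\<close>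

lemma tree_automorphism_snoc:
  assumes f: "tree_automorphism f"
  shows "\<exists>y. f (v @ [x]) = f v @ [y]"
proof (induction v arbitrary: x rule: rev_induct)
  case Nil
  have "tree_adj (f []) (f ([] @ [x]))"
    using f unfolding tree_automorphism_def tree_adj_def by blast
  moreover have "f [] = []"
    using f by (simp add: tree_automorphism_def)
  ultimately show ?case
    by (auto simp: tree_adj_def)
next
  case (snoc z u)
  have "tree_adj (f (u @ [z])) (f ((u @ [z]) @ [x]))"
    using f unfolding tree_automorphism_def tree_adj_def by blast
  then consider y where "f ((u @ [z]) @ [x]) = f (u @ [z]) @ [y]"
    | y where "f (u @ [z]) = f ((u @ [z]) @ [x]) @ [y]"
    by (auto simp: tree_adj_def)
  then show ?case
  proof cases
    case 2
    obtain y' where "f (u @ [z]) = f u @ [y']"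
      using snoc by blast
    then have "f u = f ((u @ [z]) @ [x])"
      using 2 by simp
    then have "u = (u @ [z]) @ [x]"
      using f by (metis bij_def injD tree_automorphism_def)
    then show ?thesis by simp
  qed auto
qed

lemma tree_automorphism_append:
  assumes f: "tree_automorphism f"
  shows "\<exists>u. f (v @ w) = f v @ u \<and> length u = length w"
proof (induction w rule: rev_induct)
  case (snoc x w)
  then obtain u where "f (v @ w) = f v @ u" "length u = length w"
    by auto
  then show ?case
    using tree_automorphism_snoc[OF f, of "v @ w" x] by auto
qed simp

lemma tree_automorphism_length [simp]:
  assumes "tree_automorphism f"
  shows "length (f v) = length v"
  using tree_automorphism_append[OF assms, of "[]" v] assms
  by (auto simp: tree_automorphism_def)

lemma tree_automorphism_take:
  assumes "tree_automorphism f"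
  shows "take n (f v) = f (take n v)"
proof -
  obtain u where "f (take n v @ drop n v) = f (take n v) @ u" "length u = length (drop n v)"
    using tree_automorphism_append[OF assms] by blast
  then show ?thesis
    using assms by (cases "n \<le> length v") (auto simp: min_def)
qed

text \<open>When \<open>f\<close> fixes \<open>v\<close>, the prefix that \<open>psi_at\<close>
  drops is always \<open>v\<close>, so no information is lost.\<close>

lemma tree_automorphism_stab_append:
  assumes "tree_automorphism f" "f v = v"
  shows "f (v @ w) = v @ psi_at v f w"
  using tree_automorphism_append[OF assms(1), of v w] assms(2) by (auto simp: psi_at_def)

lemma tree_automorphism_inv:
  assumes f: "tree_automorphism f"
  shows "tree_automorphism (fun_inv f)"
  unfolding tree_automorphism_def
proof (intro conjI allI)
  have b: "bij f" using f by (simp add: tree_automorphism_def)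
  then show "bij (fun_inv f)" by (rule bij_imp_bij_inv)
  show "fun_inv f [] = []"
    using f b by (metis bij_inv_eq_iff tree_automorphism_def)
  show "tree_adj (fun_inv f v) (fun_inv f w) \<longleftrightarrow> tree_adj v w" for v w
    using f b by (metis bij_inv_eq_iff tree_automorphism_def)
qed

lemma Aut_tree_mult [simp]: "f \<otimes>\<^bsub>Aut_tree\<^esub> g = f \<circ> g"
  and Aut_tree_one [simp]: "\<one>\<^bsub>Aut_tree\<^esub> = id"
  by (simp_all add: Aut_tree_def)

lemma group_Aut_tree: "group Aut_tree"
proof (rule groupI)
  fix f :: "'a list \<Rightarrow> 'a list" assume "f \<in> carrier Aut_tree"
  then show "\<exists>g\<in>carrier Aut_tree. g \<otimes>\<^bsub>Aut_tree\<^esub> f = \<one>\<^bsub>Aut_tree\<^esub>"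
    using tree_automorphism_inv[of f]
    by (intro bexI[of _ "fun_inv f"]) (auto simp: Aut_tree_def tree_automorphism_def bij_is_inj)
qed (auto simp: Aut_tree_def tree_automorphism_def bij_comp fun.map_comp)

text \<open>The copy of \<open>k\<close> at the vertex \<open>v\<close>: its section at
  \<open>v\<close> is \<open>k\<close>, and every word without prefix \<open>v\<close>, in
  particular every shorter word, is fixed.\<close>

definition graft :: "'a list \<Rightarrow> ('a list \<Rightarrow> 'a list) \<Rightarrow> 'a list \<Rightarrow> 'a list" where
  "graft v k = (\<lambda>w. if take (length v) w = v then v @ k (drop (length v) w) else w)"

lemma graft_Nil [simp]: "graft [] k = k"
  by (simp add: graft_def)

text \<open>Peeling off the first letter allows the branching condition, which concerns only the
  first level, to be iterated.\<close>

lemma graft_Cons: "graft (x # v) k = graft [x] (graft v k)"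
proof
  show "graft (x # v) k w = graft [x] (graft v k) w" for w
    by (cases w) (auto simp: graft_def)
qed

text \<open>A ray is a function \<open>\<xi> :: nat \<Rightarrow> 'a\<close>, passing through the vertices \<open>ray \<xi> n\<close>.\<close>

definition ray :: "(nat \<Rightarrow> 'a) \<Rightarrow> nat \<Rightarrow> 'a list" where
  "ray \<xi> n = map \<xi> [0..<n]"

lemma length_ray [simp]: "length (ray \<xi> n) = n"
  by (simp add: ray_def)

lemma take_ray: "m \<le> n \<Longrightarrow> take m (ray \<xi> n) = ray \<xi> m"
  by (simp add: ray_def take_map)

lemma ray_inject:
  assumes "\<And>n. ray \<xi> n = ray \<eta> n"
  shows "\<xi> = \<eta>"
proof
  fix n
  show "\<xi> n = \<eta> n"
    using assms[of "Suc n"] by (simp add: ray_def)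
qed

text \<open>Cantor's diagonal argument; two letters suffice for a map \<open>other\<close> without
  fixed points.\<close>

lemma uncountable_rays:
  assumes "CARD('a::finite) \<ge> 2"
  shows "uncountable (UNIV :: (nat \<Rightarrow> 'a) set)"
proof
  assume "countable (UNIV :: (nat \<Rightarrow> 'a) set)"
  then obtain F :: "nat \<Rightarrow> nat \<Rightarrow> 'a" where F: "range F = UNIV"
    by (metis UNIV_not_empty range_from_nat_into)
  have "\<exists>y. y \<noteq> x" for x :: 'a
  proof (rule ccontr)
    assume "\<nexists>y. y \<noteq> x"
    then have "(UNIV :: 'a set) = {x}" by auto
    then have "CARD('a) = 1" by (metis is_singletonI is_singleton_altdef)
    then show False using assms by simp
  qed
  then obtain other :: "'a \<Rightarrow> 'a" where other: "\<And>x. other x \<noteq> x"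
    by metis
  obtain n where "F n = (\<lambda>n. other (F n n))"
    using F by (metis UNIV_I image_iff)
  then show False using other by metis
qed

section \<open>Groups of tree automorphisms\<close>

locale tree_subgroup =
  fixes G :: "('a::finite list \<Rightarrow> 'a list) set"
  assumes G: "subgroup G Aut_tree"
begin

sublocale group "tree_group G"
  using G group_Aut_tree by (rule subgroup.subgroup_is_group)

lemma automorphism: "g \<in> G \<Longrightarrow> tree_automorphism g"
  using subgroup.mem_carrier[OF G, of g] by (simp add: Aut_tree_def)

lemma tree_inv [simp]:
  assumes "g \<in> G"
  shows "inv\<^bsub>tree_group G\<^esub> g = fun_inv g"
proof -
  have "inv\<^bsub>tree_group G\<^esub> g \<circ> g = id"
    using l_inv[of g] assms by simp
  then show ?thesis
    using automorphism[OF assms]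
    by (metis bij_def comp_assoc comp_id id_comp inv_unique_comp surj_iff tree_automorphism_def)
qed

lemma inv_closed_tree: "g \<in> G \<Longrightarrow> fun_inv g \<in> G"
  using inv_closed[of g] by simp

lemma bij_tree: "g \<in> G \<Longrightarrow> bij g"
  using automorphism by (auto simp: tree_automorphism_def)

lemma inv_apply: "g \<in> G \<Longrightarrow> fun_inv g (g v) = v" "g \<in> G \<Longrightarrow> g (fun_inv g v) = v"
  using bij_tree by (auto simp: bij_is_inj bij_is_surj surj_f_inv_f)

lemma tree_subgroupI:
  assumes "H \<subseteq> G" "id \<in> H" "\<And>g. g \<in> H \<Longrightarrow> fun_inv g \<in> H" "\<And>g h. g \<in> H \<Longrightarrow> h \<in> H \<Longrightarrow> g \<circ> h \<in> H"
  shows "subgroup H (tree_group G)"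
  using assms by (intro subgroupI) auto

section \<open>Vertex stabilizers and their sections\<close>

lemma finite_rcosets_vertex_stab:
  "subgroup (vertex_stab G v) (tree_group G) \<and> finite (rcosets\<^bsub>tree_group G\<^esub> vertex_stab G v)"
proof
  show S: "subgroup (vertex_stab G v) (tree_group G)"
  proof (rule tree_subgroupI)
    show "id \<in> vertex_stab G v"
      using one_closed by (simp add: vertex_stab_def)
    show "fun_inv g \<in> vertex_stab G v" if "g \<in> vertex_stab G v" for g
      using that inv_closed_tree inv_apply(1)[of g v] by (auto simp: vertex_stab_def)
    show "g \<circ> h \<in> vertex_stab G v" if "g \<in> vertex_stab G v" "h \<in> vertex_stab G v" for g h
      using that m_closed[of g h] by (auto simp: vertex_stab_def)
  qed (auto simp: vertex_stab_def)
  show "finite (rcosets\<^bsub>tree_group G\<^esub> vertex_stab G v)"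
  proof (rule finite_rcosetsI[OF S])
    \<comment> \<open>Orbit-stabilizer for right cosets: \<open>g \<circ> fun_inv h\<close> fixes
      \<open>v\<close> when the inverses of \<open>g\<close> and \<open>h\<close> agree at
      \<open>v\<close>, and their values stay in the finite level of \<open>v\<close>.\<close>
    have "(\<lambda>g. fun_inv g v) ` G \<subseteq> {w. set w \<subseteq> UNIV \<and> length w = length v}"
      using automorphism inv_closed_tree by auto
    then have "finite ((\<lambda>g. fun_inv g v) ` G)"
      by (rule finite_subset) (rule finite_lists_length_eq[OF finite])
    then show "finite ((\<lambda>g. fun_inv g v) ` carrier (tree_group G))"
      by simp
    fix g h assume "g \<in> carrier (tree_group G)" "h \<in> carrier (tree_group G)" "fun_inv g v = fun_inv h v"
    then show "g \<otimes>\<^bsub>tree_group G\<^esub> inv\<^bsub>tree_group G\<^esub> h \<in> vertex_stab G v"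
      using m_closed[of g "fun_inv h"] inv_closed_tree[of h] inv_apply(2)[of g v]
      by (auto simp: vertex_stab_def simp flip: \<open>fun_inv g v = fun_inv h v\<close>)
  qed
qed

lemma psi_at_hom:
  assumes "self_similar G"
  shows "psi_at v \<in> hom (tree_group G\<lparr>carrier := vertex_stab G v\<rparr>) (tree_group G)"
proof (rule homI)
  fix f g
  assume "f \<in> carrier (tree_group G\<lparr>carrier := vertex_stab G v\<rparr>)"
    and "g \<in> carrier (tree_group G\<lparr>carrier := vertex_stab G v\<rparr>)"
  then have "g \<in> G" "g v = v"
    by (auto simp: vertex_stab_def)
  then have "g (v @ w) = v @ psi_at v g w" for w
    by (simp add: tree_automorphism_stab_append automorphism)
  then show "psi_at v (f \<otimes>\<^bsub>tree_group G\<lparr>carrier := vertex_stab G v\<rparr>\<^esub> g)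
      = psi_at v f \<otimes>\<^bsub>tree_group G\<^esub> psi_at v g"
    by (auto simp: Aut_tree_def psi_at_def)
qed (use assms in \<open>auto simp: self_similar_def\<close>)

section \<open>Branching subgroups\<close>

text \<open>
  The subgroup of those elements of \<open>Stab\<^sub>G(n)\<close> with all sections at level \<open>n\<close> in \<open>K\<close> has finite
  index, and each such element is the product of the grafts of its sections.
\<close>

lemma finite_rcosets_if_grafts:
  assumes ss: "self_similar G" and K: "finite_index_subgroup K (tree_group G)"
    and W: "subgroup W (tree_group G)"
    and grafts: "\<And>v k. length v = n \<Longrightarrow> k \<in> K \<Longrightarrow> graft v k \<in> W"
  shows "finite (rcosets\<^bsub>tree_group G\<^esub> W)"
proof -
  let ?P = "\<lambda>v. {s \<in> vertex_stab G v. psi_at v s \<in> K}"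
  let ?L = "{v :: 'a list. length v = n}"
  have finL: "finite ?L"
    using finite_lists_length_eq[of "UNIV :: 'a set" n] by simp
  have neL: "?L \<noteq> {}"
    using length_replicate[of n "undefined :: 'a"] by (metis (mono_tags) empty_iff mem_Collect_eq)
  have Kf: "subgroup K (tree_group G)" "finite (rcosets\<^bsub>tree_group G\<^esub> K)"
    using K by (simp_all add: finite_index_subgroup_def)
  note P = finite_rcosets_preimage[OF finite_rcosets_vertex_stab[THEN conjunct1]
      finite_rcosets_vertex_stab[THEN conjunct2] is_group Kf psi_at_hom[OF ss]]
  note P = P[THEN conjunct1] P[THEN conjunct2]
  have "(\<Inter>v\<in>?L. ?P v) \<subseteq> W"
  proof
    fix g assume g: "g \<in> (\<Inter>v\<in>?L. ?P v)"
    have gG: "g \<in> G"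
      using g neL by (auto simp: vertex_stab_def)
    \<comment> \<open>\<open>M S\<close> acts as \<open>g\<close> below the vertices of
      \<open>S\<close> and trivially elsewhere. It is the partial product of grafts over
      \<open>S\<close>, built up one vertex at a time.\<close>
    define M where "M S = (\<lambda>w. if take n w \<in> S then g w else w)" for S
    have "M S \<in> W" if "finite S" "S \<subseteq> ?L" for S
      using that
    proof (induction rule: finite_induct)
      case empty
      have "M {} = id" by (auto simp: M_def)
      moreover have "id \<in> W" using subgroup.one_closed[OF W] by simp
      ultimately show ?case by (simp only:)
    next
      case (insert v S)
      then have v: "length v = n" by simp
      have gv: "g v = v" "psi_at v g \<in> K"
        using g v by (auto simp: vertex_stab_def)
      have "M (insert v S) w = (graft v (psi_at v g) \<circ> M S) w" for w
      proof (cases "take n w = v")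
        case True
        then obtain u where "w = v @ u"
          by (metis append_take_drop_id)
        then show ?thesis
          using insert.hyps tree_automorphism_stab_append[OF automorphism[OF gG] gv(1), of u] v
          by (simp add: M_def graft_def)
      next
        case False
        have "take n (g w) = take n w" if "take n w \<in> S"
        proof -
          have "g (take n w) = take n w"
            using g that insert.prems by (auto simp: vertex_stab_def)
          then show ?thesis
            by (simp add: tree_automorphism_take automorphism[OF gG])
        qed
        then show ?thesis
          using False v by (auto simp: M_def graft_def)
      qed
      then have eq: "M (insert v S) = graft v (psi_at v g) \<circ> M S" by auto
      have "M S \<in> W" using insert by simp
      then have "graft v (psi_at v g) \<circ> M S \<in> W"
        using subgroup.m_closed[OF W grafts[OF v gv(2)], of "M S"] by simp
      then show ?case by (simp only: eq)
    qed
    then have "M ?L \<in> W"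
      using finL by simp
    moreover have "M ?L = g"
    proof
      fix w
      show "M ?L w = g w"
      proof (cases "length w \<ge> n")
        case False
        \<comment> \<open>A word shorter than \<open>n\<close> is fixed by \<open>M ?L\<close>. It
          is fixed by \<open>g\<close> as well, being a prefix of the fixed vertex \<open>u\<close>
          of level \<open>n\<close>.\<close>
        define u where "u = w @ replicate (n - length w) undefined"
        have "g u = u"
          using g False by (auto simp: vertex_stab_def u_def)
        then have "g w = w"
          using tree_automorphism_take[OF automorphism[OF gG], of "length w" u]
          by (simp add: u_def)
        then show ?thesis by (simp add: M_def)
      qed (simp add: M_def)
    qed
    ultimately show "g \<in> W" by simp
  qed
  moreover have "subgroup (\<Inter>v\<in>?L. ?P v) (tree_group G)"
    using subgroups_Inter[of "?P ` ?L"] neL P(1) by auto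
  moreover have "finite (rcosets\<^bsub>tree_group G\<^esub> (\<Inter>v\<in>?L. ?P v))"
    using finL neL P by (rule finite_rcosets_INT)
  ultimately show ?thesis
    using finite_rcosets_mono[OF _ W] by blast
qed

text \<open>Induction on \<open>v\<close>: the tuple with \<open>graft v k\<close> at
  \<open>x\<close> and \<open>id\<close> elsewhere lies in the power of \<open>K\<close>, so it
  comes from an element of \<open>K\<close> fixing the first level. Such an element is determined by
  its sections, hence equals \<open>graft (x # v) k\<close>.\<close>

lemma graft_closed:
  assumes K: "K \<subseteq> G" "id \<in> K"
    and br: "(\<Pi>\<^sub>E x\<in>UNIV. K) \<subseteq> psi_one ` (K \<inter> level_stab G 1)"
    and k: "k \<in> K"
  shows "graft v k \<in> K"
proof (induction v)
  case Nil
  then show ?case using k by simp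
next
  case (Cons x v)
  let ?h = "graft v k"
  have "(\<lambda>y. if y = x then ?h else id) \<in> (\<Pi>\<^sub>E x\<in>UNIV. K)"
    using Cons K(2) by auto
  then have "(\<lambda>y. if y = x then ?h else id) \<in> psi_one ` (K \<inter> level_stab G 1)"
    using br by blast
  then obtain g where g: "g \<in> K" "g \<in> level_stab G 1"
    "psi_one g = (\<lambda>y. if y = x then ?h else id)"
    by (elim imageE IntE) simp
  have "g w = graft [x] ?h w" for w
  proof (cases w)
    case Nil
    then show ?thesis
      using automorphism g K by (auto simp: tree_automorphism_def graft_def)
  next
    case (Cons y u)
    have "g [y] = [y]"
      using g(2) by (auto simp: level_stab_def tree_level_def vertex_stab_def)
    moreover have "tree_automorphism g"
      using automorphism g K by blast
    ultimately have "g ([y] @ u) = [y] @ psi_one g y u"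
      using tree_automorphism_stab_append[of g "[y]" u] by (simp add: psi_one_def)
    then show ?thesis
      unfolding g(3) using Cons by (auto simp: graft_def)
  qed
  then have "g = graft (x # v) k"
    by (auto simp: graft_Cons[of x v k])
  then show ?case using g by simp
qed

section \<open>Stabilizers of finite orbits of rays\<close>

text \<open>The orbit of the ray is recorded through its vertices on each level. For a finite
  subgroup \<open>Q\<close> this gives the setwise stabilizer of the orbit, as a finite set of rays
  is determined by these vertices.\<close>

definition orbit_stab :: "('a list \<Rightarrow> 'a list) set \<Rightarrow> (nat \<Rightarrow> 'a) \<Rightarrow> ('a list \<Rightarrow> 'a list) set" where
  "orbit_stab Q \<xi> = {g \<in> G. \<forall>n. g ` (\<lambda>q. q (ray \<xi> n)) ` Q = (\<lambda>q. q (ray \<xi> n)) ` Q}"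

lemma orbit_stab_subgroup: "subgroup (orbit_stab Q \<xi>) (tree_group G)"
proof (rule tree_subgroupI)
  show "id \<in> orbit_stab Q \<xi>"
    using one_closed by (simp add: orbit_stab_def)
  show "fun_inv g \<in> orbit_stab Q \<xi>" if "g \<in> orbit_stab Q \<xi>" for g
  proof -
    have g: "g \<in> G" and eq: "g ` (\<lambda>q. q (ray \<xi> n)) ` Q = (\<lambda>q. q (ray \<xi> n)) ` Q" for n
      using that by (auto simp: orbit_stab_def)
    have "fun_inv g ` (\<lambda>q. q (ray \<xi> n)) ` Q = (\<lambda>q. q (ray \<xi> n)) ` Q" for n
      using image_inv_f_f[OF bij_is_inj[OF bij_tree[OF g]], of "(\<lambda>q. q (ray \<xi> n)) ` Q"] eq[of n]
      by simp
    then show ?thesis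
      using inv_closed_tree[OF g] by (simp add: orbit_stab_def)
  qed
  show "g \<circ> h \<in> orbit_stab Q \<xi>" if "g \<in> orbit_stab Q \<xi>" "h \<in> orbit_stab Q \<xi>" for g h
  proof -
    have "(g \<circ> h) ` A = g ` h ` A" for A
      by (simp add: image_comp)
    then show ?thesis
      using that m_closed[of g h] unfolding orbit_stab_def by simp
  qed
qed (auto simp: orbit_stab_def)

lemma subset_orbit_stab:
  assumes Q: "subgroup Q (tree_group G)"
  shows "Q \<subseteq> orbit_stab Q \<xi>"
proof
  fix p assume p: "p \<in> Q"
  have pG: "p \<in> G" using subgroup.mem_carrier[OF Q p] by simp
  have "p ` (\<lambda>q. q w) ` Q = (\<lambda>q. q w) ` Q" for w
  proof (intro equalityI subsetI)
    fix u assume "u \<in> p ` (\<lambda>q. q w) ` Q"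
    then obtain q where "q \<in> Q" "u = (p \<circ> q) w" by auto
    then show "u \<in> (\<lambda>q. q w) ` Q"
      using subgroup.m_closed[OF Q p, of q] by (intro image_eqI[of _ _ "p \<circ> q"]) auto
  next
    fix u assume "u \<in> (\<lambda>q. q w) ` Q"
    then obtain q where q: "q \<in> Q" "u = q w" by auto
    have "fun_inv p \<circ> q \<in> Q"
      using subgroup.m_closed[OF Q subgroup.m_inv_closed[OF Q p] q(1)] pG by simp
    moreover have "u = p ((fun_inv p \<circ> q) w)"
      using q inv_apply(2)[OF pG] by simp
    ultimately show "u \<in> p ` (\<lambda>q. q w) ` Q" by blast
  qed
  then show "p \<in> orbit_stab Q \<xi>"
    using pG by (simp add: orbit_stab_def)
qed

text \<open>
  With \<open>r\<close> coset representatives, the orbit of \<open>ray \<xi> n\<close> under \<open>G\<close> would have at most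
  \<open>r |Q|\<close> elements, but it is the whole level, which has at least \<open>2\<^sup>n\<close>.
\<close>

lemma infinite_index_orbit_stab:
  assumes d: "CARD('a) \<ge> 2" and st: "spherically_transitive G"
    and Q: "subgroup Q (tree_group G)" "finite Q"
  shows "infinite_index_subgroup (orbit_stab Q \<xi>) (tree_group G)"
  unfolding infinite_index_subgroup_def
proof (intro conjI notI)
  let ?H = "orbit_stab Q \<xi>"
  show H: "subgroup ?H (tree_group G)" by (rule orbit_stab_subgroup)
  assume "finite (rcosets\<^bsub>tree_group G\<^esub> ?H)"
  then obtain R where R: "finite R" "R \<subseteq> G"
    "\<And>g. g \<in> G \<Longrightarrow> \<exists>r\<in>R. g \<otimes>\<^bsub>tree_group G\<^esub> inv\<^bsub>tree_group G\<^esub> r \<in> ?H"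
    unfolding finite_rcosets_iff[OF H] by auto
  \<comment> \<open>Chosen so that the level has at least \<open>2 ^ n\<close> vertices, more than
    the \<open>n\<close> pairs in \<open>R \<times> Q\<close>.\<close>
  define n where "n = card (R \<times> Q)"
  let ?u = "ray \<xi> n"
  have "{v. set v \<subseteq> (UNIV :: 'a set) \<and> length v = n} \<subseteq> (\<lambda>(r, q). fun_inv r (q ?u)) ` (R \<times> Q)"
  proof
    fix v :: "'a list" assume "v \<in> {v. set v \<subseteq> UNIV \<and> length v = n}"
    then have "v \<in> tree_level n" "?u \<in> tree_level n"
      by (simp_all add: tree_level_def)
    then obtain g where g: "g \<in> G" "g v = ?u"
      using st unfolding spherically_transitive_def by meson
    obtain r where r: "r \<in> R" "g \<circ> fun_inv r \<in> ?H"
    proof -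
      obtain r where "r \<in> R" "g \<otimes>\<^bsub>tree_group G\<^esub> inv\<^bsub>tree_group G\<^esub> r \<in> ?H"
        using R(3)[OF g(1)] by blast
      then show ?thesis
        using that R(2) by (simp add: subsetD)
    qed
    have eq: "(g \<circ> fun_inv r) ` (\<lambda>q. q ?u) ` Q = (\<lambda>q. q ?u) ` Q"
      using r(2) by (simp add: orbit_stab_def)
    \<comment> \<open>As \<open>id\<close> is in \<open>Q\<close>, the vertex
      \<open>?u = g v\<close> lies in the set preserved by \<open>g \<circ> fun_inv r\<close>. It
      thus has a preimage \<open>q ?u\<close> there, and cancelling \<open>g\<close> expresses
      \<open>v\<close> through \<open>r\<close> and \<open>q\<close>.\<close>
    have "?u \<in> (\<lambda>q. q ?u) ` Q"
      using subgroup.one_closed[OF Q(1)] by (intro image_eqI[of _ _ id]) auto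
    then have "?u \<in> (g \<circ> fun_inv r) ` (\<lambda>q. q ?u) ` Q"
      unfolding eq .
    then obtain q where q: "q \<in> Q" "?u = (g \<circ> fun_inv r) (q ?u)"
      by blast
    have "g v = g (fun_inv r (q ?u))"
      using trans[OF g(2) q(2)] by (simp only: comp_apply)
    then have "v = fun_inv r (q ?u)"
      using bij_is_inj[OF bij_tree[OF g(1)]] by (simp add: inj_eq)
    then show "v \<in> (\<lambda>(r, q). fun_inv r (q ?u)) ` (R \<times> Q)"
      using r q by (intro image_eqI[of _ _ "(r, q)"]) auto
  qed
  then have "card {v. set v \<subseteq> (UNIV :: 'a set) \<and> length v = n} \<le> n"
    unfolding n_def by (intro surj_card_le) (simp_all add: R(1) Q(2))
  then have "CARD('a) ^ n \<le> n"
    by (simp only: card_lists_length_eq[OF finite])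
  moreover have "2 ^ n \<le> CARD('a) ^ n"
    using d by (rule power_mono) simp
  ultimately show False
    using less_exp[of n] by simp
qed

text \<open>A vertex \<open>q (ray \<xi> n)\<close> below \<open>v\<close> would force
  \<open>v\<close> itself into the orbit at level \<open>length v\<close>. So the graft fixes every
  vertex of the orbit pointwise.\<close>

lemma graft_mem_orbit_stab:
  assumes Q: "subgroup Q (tree_group G)"
    and k: "graft v k \<in> G" and v: "v \<notin> (\<lambda>q. q (ray \<xi> (length v))) ` Q"
  shows "graft v k \<in> orbit_stab Q \<xi>"
proof -
  have "graft v k (q (ray \<xi> n)) = q (ray \<xi> n)" if "q \<in> Q" for q n
  proof -
    have q: "tree_automorphism q"
      using automorphism subgroup.mem_carrier[OF Q that] by simp
    have "take (length v) (q (ray \<xi> n)) \<noteq> v"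
    proof
      assume eq: "take (length v) (q (ray \<xi> n)) = v"
      then have "length (take (length v) (q (ray \<xi> n))) = length v"
        by (rule arg_cong)
      then have "length v \<le> n"
        using q by simp
      then have "v = q (ray \<xi> (length v))"
        using eq q by (simp add: tree_automorphism_take take_ray)
      then show False using v that by blast
    qed
    then show ?thesis by (simp add: graft_def)
  qed
  then show ?thesis
    using k by (auto simp: orbit_stab_def image_image)
qed

text \<open>Automorphisms commute with truncation, so vertices once distinct stay distinct at deeper
  levels. Hence the maximum of the finitely many separating levels works for all \<open>q\<close> at
  once.\<close>

lemma rays_disjoint_orbits:
  assumes Q: "subgroup Q (tree_group G)" "finite Q"
    and no: "\<And>q. q \<in> Q \<Longrightarrow> \<exists>n. q (ray \<xi> n) \<noteq> ray \<eta> n"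
  shows "\<exists>n. (\<lambda>q. q (ray \<xi> n)) ` Q \<inter> (\<lambda>q. q (ray \<eta> n)) ` Q = {}"
proof -
  obtain N where N: "\<And>q. q \<in> Q \<Longrightarrow> q (ray \<xi> (N q)) \<noteq> ray \<eta> (N q)"
    using no by metis
  define n where "n = Max (insert 0 (N ` Q))"
  have ne: "q (ray \<xi> n) \<noteq> ray \<eta> n" if "q \<in> Q" for q
  proof
    have q: "tree_automorphism q"
      using automorphism subgroup.mem_carrier[OF Q(1) that] by simp
    have le: "N q \<le> n"
      using Q(2) that by (simp add: n_def)
    assume "q (ray \<xi> n) = ray \<eta> n"
    then have "take (N q) (q (ray \<xi> n)) = take (N q) (ray \<eta> n)" by simp
    then show False
      using N[OF that] q le by (simp add: tree_automorphism_take take_ray)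
  qed
  \<comment> \<open>A common vertex of the two orbits is moved back by the inverse of
    \<open>q\<close>, which reduces to the single element \<open>fun_inv q \<circ> p\<close> of
    \<open>Q\<close>.\<close>
  have False if pq: "p \<in> Q" "q \<in> Q" "p (ray \<xi> n) = q (ray \<eta> n)" for p q
  proof -
    have qG: "q \<in> G" using subgroup.mem_carrier[OF Q(1) pq(2)] by simp
    have "fun_inv q \<circ> p \<in> Q"
      using subgroup.m_closed[OF Q(1) subgroup.m_inv_closed[OF Q(1) pq(2)] pq(1)] qG by simp
    moreover have "(fun_inv q \<circ> p) (ray \<xi> n) = ray \<eta> n"
      using pq(3) inv_apply(1)[OF qG] by simp
    ultimately show False using ne by blast
  qed
  then show ?thesis by blast
qed

section \<open>Counting the weakly maximal subgroups that contain \<open>Q\<close>\<close>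

lemma uncountable_weakly_maximal:
  assumes d: "CARD('a) \<ge> 2" and fg: "finitely_generated_group (tree_group G)"
    and rb: "regular_branch G"
    and Q: "subgroup Q (tree_group G)" "finite Q"
  shows "uncountable {W. weakly_maximal W (tree_group G) \<and> Q \<subseteq> W}"
proof
  let ?\<W> = "{W. weakly_maximal W (tree_group G) \<and> Q \<subseteq> W}"
  assume c: "countable ?\<W>"
  obtain K where st: "spherically_transitive G" and ss: "self_similar G"
    and K: "finite_index_subgroup K (tree_group G)"
    and br: "(\<Pi>\<^sub>E x\<in>UNIV. K) \<subseteq> psi_one ` (K \<inter> level_stab G 1)"
  proof -
    obtain K where K: "spherically_transitive G" "self_similar G"
      "finite_index_subgroup K (tree_group G)"
      "subgroup (\<Pi>\<^sub>E x\<in>UNIV. K) ((product_group UNIV (\<lambda>x. Aut_tree))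
               \<lparr>carrier := psi_one ` (K \<inter> level_stab G 1)\<rparr>)"
      using rb unfolding regular_branch_def finite_index_subgroup_def by blast
    show ?thesis
      using that[OF K(1-3)] subgroup.subset[OF K(4)] by simp
  qed
  have Ks: "subgroup K (tree_group G)"
    using K by (simp add: finite_index_subgroup_def)
  have KG: "K \<subseteq> G" "id \<in> K"
    using subgroup.subset[OF Ks] subgroup.one_closed[OF Ks] by auto
  have "\<forall>\<xi>. \<exists>W. weakly_maximal W (tree_group G) \<and> orbit_stab Q \<xi> \<subseteq> W"
    using exists_weakly_maximal[OF fg] infinite_index_orbit_stab[OF d st Q] by blast
  then obtain W where W: "\<And>\<xi>. weakly_maximal (W \<xi>) (tree_group G)" "\<And>\<xi>. orbit_stab Q \<xi> \<subseteq> W \<xi>"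
    by metis
  have fibre: "\<exists>q\<in>Q. \<forall>n. q (ray \<xi> n) = ray \<eta> n" if eq: "W \<xi> = W \<eta>" for \<xi> \<eta>
  proof (rule ccontr)
    assume "\<not> ?thesis"
    then obtain n where n: "(\<lambda>q. q (ray \<xi> n)) ` Q \<inter> (\<lambda>q. q (ray \<eta> n)) ` Q = {}"
      using rays_disjoint_orbits[OF Q, of \<xi> \<eta>] by blast
    have "graft v k \<in> W \<xi>" if "length v = n" "k \<in> K" for v k
    proof -
      have "graft v k \<in> G"
        using graft_closed[OF KG br that(2)] KG by blast
      \<comment> \<open>At level \<open>n\<close> the orbits are disjoint, so \<open>v\<close>
        misses at least one of them and the graft stabilizes that one.\<close>
      then have "graft v k \<in> orbit_stab Q \<xi> \<union> orbit_stab Q \<eta>"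
        using n graft_mem_orbit_stab[OF Q(1), of v k] that(1) by blast
      then show ?thesis using W(2) eq by blast
    qed
    then show False
      using finite_rcosets_if_grafts[OF ss K] W(1)[of \<xi>]
      unfolding weakly_maximal_def infinite_index_subgroup_def by blast
  qed
  have "finite {\<eta>. W \<eta> = V}" for V
  proof (cases "\<exists>\<xi>. W \<xi> = V")
    case True
    then obtain \<xi> where \<xi>: "W \<xi> = V" by blast
    \<comment> \<open>A ray in the fibre of \<open>\<xi>\<close> is the image of
      \<open>\<xi>\<close> under some \<open>q\<close> in \<open>Q\<close>; \<open>THE\<close>
      recovers this ray from its vertices.\<close>
    have "{\<eta>. W \<eta> = V} \<subseteq> (\<lambda>q. THE \<eta>. \<forall>n. ray \<eta> n = q (ray \<xi> n)) ` Q"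
    proof
      fix \<eta> assume "\<eta> \<in> {\<eta>. W \<eta> = V}"
      then obtain q where q: "q \<in> Q" "\<forall>n. q (ray \<xi> n) = ray \<eta> n"
        using fibre[of \<xi> \<eta>] \<xi> by auto
      have "(THE \<eta>. \<forall>n. ray \<eta> n = q (ray \<xi> n)) = \<eta>"
        using q(2) by (intro the_equality) (auto intro: ray_inject)
      then show "\<eta> \<in> (\<lambda>q. THE \<eta>. \<forall>n. ray \<eta> n = q (ray \<xi> n)) ` Q"
        using q(1) by (intro image_eqI[of _ _ q]) auto
    qed
    then show ?thesis using Q(2) finite_subset by blast
  qed simp
  \<comment> \<open>Countably many values of \<open>W\<close> with finite fibres would leave only
    countably many rays.\<close>
  moreover have "(UNIV :: (nat \<Rightarrow> 'a) set) = (\<Union>V\<in>?\<W>. {\<eta>. W \<eta> = V})"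
  proof (intro equalityI subsetI)
    fix \<xi>
    have "W \<xi> \<in> ?\<W>"
      using W(1)[of \<xi>] W(2)[of \<xi>] subset_orbit_stab[OF Q(1), of \<xi>] by simp
    then show "\<xi> \<in> (\<Union>V\<in>?\<W>. {\<eta>. W \<eta> = V})" by blast
  qed simp
  ultimately have "countable (UNIV :: (nat \<Rightarrow> 'a) set)"
    using c by (metis (no_types, lifting) countable_UN countable_finite)
  then show False
    using uncountable_rays[OF d] by blast
qed

end

theorem theorem1p1:
  fixes G Q :: "('a::finite list \<Rightarrow> 'a list) set"
  assumes "CARD('a) \<ge> 2"
    and "subgroup G Aut_tree"
    and "finitely_generated_group (tree_group G)"
    and "regular_branch G"
    and "subgroup Q (tree_group G)" and "finite Q"
  shows "uncountable
    ({W. weakly_maximal W (tree_group G) \<and> Q \<subseteq> W} // automorphism_equiv (tree_group G))"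
proof -
  interpret tree_subgroup G
    using assms(2) by (rule tree_subgroup.intro)
  have "subgroup W (tree_group G)" if "weakly_maximal W (tree_group G)" for W
    using that by (simp add: weakly_maximal_def infinite_index_subgroup_def)
  then show ?thesis
    using countable_if_countable_automorphism_classes[OF assms(3),
        of "{W. weakly_maximal W (tree_group G) \<and> Q \<subseteq> W}"]
      uncountable_weakly_maximal[OF assms(1,3-6)] by auto
qed

end
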